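(* Let $V$ be a simple Yetter-Drinfeld module over $H=B(n,w,\gamma)$ with $\dim_\Bbbk V=p+1$ for some $p\ge0$, and let $v\in V$ be a standard element of type $(\alpha,\beta,h)$ with $\alpha,\beta\in\Bbbk^*$, $h\in G(H)$. Then: (1) $p+1\le n$; (2) if $p+1<n$, then $y^{p+1}\cdot v=0$; (3) $y^{p+1}\cdot v=0$ if and only if $\alpha^w=\beta^n=1$; (4) $y^{p+1}\cdot v\ne0$ if and only if $\alpha^w=\beta^n\ne1$.
   Context: $\Bbbk$ is an algebraically closed field of characteristic $0$; $n,w$ positive integers, $\gamma$ a primitive $n$-th root of unity. $H=B(n,w,\gamma)$ is the Hopf algebra generated by $x^{\pm1},g,y$ with relations $xx^{-1}=x^{-1}x=1$, $xg=gx$, $xy=yx$, $yg=\gamma gy$, $y^n=1-x^w=1-g^n$, with $\Delta(x)=x\otimes x$, $\Delta(g)=g\otimes g$, $\Delta(y)=y\otimes g+1\otimes y$, $\varepsilon(x)=\varepsilon(g)=1$, $\varepsilon(y)=0$, $S(x)=x^{-1}$, $S(g)=g^{-1}$, $S(y)=-yg^{-1}$; $G(H)=\{g^jx^k\}$. A (left-left) Yetter-Drinfeld module is a left $H$-module, left $H$-comodule $(V,\cdot,\delta)$ with $\delta(h\cdot v)=h_{(1)}v_{(-1)}S(h_{(3)})\otimes h_{(2)}\cdot v_{(0)}$; simple means no nonzero proper Yetter-Drinfeld submodules. A nonzero $v\in V$ is a standard element of type $(\alpha,\beta,h)$ if $h\in G(H)$, $\alpha,\beta\in\Bbbk^*$,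 $x\cdot v=\alpha v$, $g\cdot v=\beta v$, $\delta(v)=h\otimes v$. *)

theory Defs
  imports "HOL-Analysis.Analysis" "HOL-Computational_Algebra.Polynomial"
begin

section \<open>Ground field\<close>

definition alg_closed :: "'k::field itself \<Rightarrow> bool" where
  "alg_closed TYPE('k) \<longleftrightarrow> (\<forall>q::'k poly. 0 < degree q \<longrightarrow> (\<exists>z. poly q z = 0))"

definition primitive_root :: "nat \<Rightarrow> 'k::field \<Rightarrow> bool" where
  "primitive_root n c \<longleftrightarrow> 0 < n \<and> c ^ n = 1 \<and> (\<forall>m. 0 < m \<and> m < n \<longrightarrow> c ^ m \<noteq> 1)"

section \<open>The Hopf algebra H = B(n,w,gamma) in the basis x^k g^j y^i\<close>

text \<open>Basis index (k,j,i) stands for x^k g^j y^i, with k an integer and 0 \<le> j,i < n.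
  Elements of H are finitely supported coefficient functions on basis indices;
  H \<otimes> H and H \<otimes> H \<otimes> H are represented likewise on pairs/triples of indices.\<close>

type_synonym bidx = "int \<times> nat \<times> nat"
type_synonym 'k helt = "bidx \<Rightarrow> 'k"

definition Bset :: "nat \<Rightarrow> bidx set" where
  "Bset n = {(k,j,i). j < n \<and> i < n}"

definition supp :: "('a \<Rightarrow> 'b::zero) \<Rightarrow> 'a set" where
  "supp f = {s. f s \<noteq> 0}"

definition bel :: "bidx \<Rightarrow> 'k::zero_neq_one helt" where
  "bel t = (\<lambda>s. if s = t then 1 else 0)"

text \<open>nrm n w (k,j,i) is the basis expansion of x^k g^j y^i for arbitrary j,i:
  g^n = x^w and y^n = 1 - x^w.\<close>
definition nrm :: "nat \<Rightarrow> nat \<Rightarrow> bidx \<Rightarrow> 'k::comm_ring_1 helt" where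
  "nrm n w t = (case t of (k,j,i) \<Rightarrow>
     (\<lambda>s. \<Sum>m\<le>i div n. of_int ((-1) ^ m * int (i div n choose m)) *
          bel (k + int (w * (j div n + m)), j mod n, i mod n) s))"

text \<open>Product of basis elements, using y g = gamma g y and central x.\<close>
definition bmul :: "nat \<Rightarrow> nat \<Rightarrow> 'k::comm_ring_1 \<Rightarrow> bidx \<Rightarrow> bidx \<Rightarrow> 'k helt" where
  "bmul n w \<gamma> s s' = (case s of (k,j,i) \<Rightarrow> case s' of (k',j',i') \<Rightarrow>
      (\<lambda>t. \<gamma> ^ (i * j') * nrm n w (k + k', j + j', i + i') t))"

definition hmul :: "nat \<Rightarrow> nat \<Rightarrow> 'k::comm_ring_1 \<Rightarrow> 'k helt \<Rightarrow> 'k helt \<Rightarrow> 'k helt" where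
  "hmul n w \<gamma> a b = (\<lambda>t. \<Sum>s\<in>supp a. \<Sum>s'\<in>supp b. a s * b s' * bmul n w \<gamma> s s' t)"

definition hone :: "'k::comm_ring_1 helt" where
  "hone = bel (0,0,0)"

definition hpow :: "nat \<Rightarrow> nat \<Rightarrow> 'k::comm_ring_1 \<Rightarrow> 'k helt \<Rightarrow> nat \<Rightarrow> 'k helt" where
  "hpow n w \<gamma> a m = ((hmul n w \<gamma> a) ^^ m) hone"

text \<open>Generators as elements of H.\<close>
definition hx :: "nat \<Rightarrow> nat \<Rightarrow> 'k::comm_ring_1 helt" where "hx n w = nrm n w (1,0,0)"
definition hg :: "nat \<Rightarrow> nat \<Rightarrow> 'k::comm_ring_1 helt" where "hg n w = nrm n w (0,1,0)"
definition hy :: "nat \<Rightarrow> nat \<Rightarrow> 'k::comm_ring_1 helt" where "hy n w = nrm n w (0,0,1)"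

text \<open>Antipode on basis elements: S(x^k g^j y^i) = S(y)^i S(g)^j S(x)^k, with
  S(x) = x^{-1}, S(g) = g^{-1} = g^{n-1} x^{-w}, S(y) = - y g^{-1}.\<close>
definition Sg :: "nat \<Rightarrow> nat \<Rightarrow> 'k::comm_ring_1 helt" where
  "Sg n w = nrm n w (- int w, n - 1, 0)"

definition Sy :: "nat \<Rightarrow> nat \<Rightarrow> 'k::comm_ring_1 \<Rightarrow> 'k helt" where
  "Sy n w \<gamma> = (\<lambda>t. - hmul n w \<gamma> (hy n w) (Sg n w) t)"

definition antip :: "nat \<Rightarrow> nat \<Rightarrow> 'k::comm_ring_1 \<Rightarrow> bidx \<Rightarrow> 'k helt" where
  "antip n w \<gamma> b = (case b of (k,j,i) \<Rightarrow>
     hmul n w \<gamma> (hpow n w \<gamma> (Sy n w \<gamma>) i)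
       (hmul n w \<gamma> (hpow n w \<gamma> (Sg n w) j) (nrm n w (-k,0,0))))"

text \<open>Counit on basis elements.\<close>
definition counit :: "bidx \<Rightarrow> 'k::comm_ring_1" where
  "counit b = (case b of (k,j,i) \<Rightarrow> if i = 0 then 1 else 0)"

text \<open>H \<otimes> H.\<close>
definition ten :: "'k::comm_ring_1 helt \<Rightarrow> 'k helt \<Rightarrow> (bidx \<times> bidx \<Rightarrow> 'k)" where
  "ten a b = (\<lambda>(t1,t2). a t1 * b t2)"

definition tmul :: "nat \<Rightarrow> nat \<Rightarrow> 'k::comm_ring_1 \<Rightarrow> (bidx \<times> bidx \<Rightarrow> 'k) \<Rightarrow> (bidx \<times> bidx \<Rightarrow> 'k)
    \<Rightarrow> (bidx \<times> bidx \<Rightarrow> 'k)" where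
  "tmul n w \<gamma> A B = (\<lambda>(t1,t2). \<Sum>s\<in>supp A. \<Sum>s'\<in>supp B.
      A s * B s' * bmul n w \<gamma> (fst s) (fst s') t1 * bmul n w \<gamma> (snd s) (snd s') t2)"

text \<open>Coproduct on basis elements: Delta(x^k g^j y^i) = (x^k g^j \<otimes> x^k g^j) Delta(y)^i,
  Delta(y) = y \<otimes> g + 1 \<otimes> y.\<close>
definition Dy :: "nat \<Rightarrow> nat \<Rightarrow> (bidx \<times> bidx \<Rightarrow> 'k::comm_ring_1)" where
  "Dy n w = (\<lambda>t. ten (hy n w) (hg n w) t + ten hone (hy n w) t)"

definition comult :: "nat \<Rightarrow> nat \<Rightarrow> 'k::comm_ring_1 \<Rightarrow> bidx \<Rightarrow> (bidx \<times> bidx \<Rightarrow> 'k)" where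
  "comult n w \<gamma> b = (case b of (k,j,i) \<Rightarrow>
     tmul n w \<gamma> (ten (nrm n w (k,j,0)) (nrm n w (k,j,0))) ((tmul n w \<gamma> (Dy n w) ^^ i) (ten hone hone)))"

text \<open>(Delta \<otimes> id) Delta on basis elements: coefficient of t1 \<otimes> t2 \<otimes> t3.\<close>
definition comult2 :: "nat \<Rightarrow> nat \<Rightarrow> 'k::comm_ring_1 \<Rightarrow> bidx \<Rightarrow> (bidx \<times> bidx \<times> bidx \<Rightarrow> 'k)" where
  "comult2 n w \<gamma> b = (\<lambda>(t1,t2,t3). \<Sum>s\<in>supp (comult n w \<gamma> b).
      (if snd s = t3 then comult n w \<gamma> b s * comult n w \<gamma> (fst s) (t1,t2) else 0))"

section \<open>Yetter-Drinfeld modules on V = 'k^'d\<close>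

text \<open>A left H-module structure is given by the actions X, Xi, G, Y of the generators
  x, x^{-1}, g, y, subject to the defining relations of H.\<close>
definition hmodule :: "nat \<Rightarrow> nat \<Rightarrow> 'k::field \<Rightarrow>
    ('k^'d \<Rightarrow> 'k^'d) \<Rightarrow> ('k^'d \<Rightarrow> 'k^'d) \<Rightarrow> ('k^'d \<Rightarrow> 'k^'d) \<Rightarrow> ('k^'d \<Rightarrow> 'k^'d) \<Rightarrow> bool" where
  "hmodule n w \<gamma> X Xi G Y \<longleftrightarrow>
     Vector_Spaces.linear (*s) (*s) X \<and> Vector_Spaces.linear (*s) (*s) Xi \<and>
     Vector_Spaces.linear (*s) (*s) G \<and> Vector_Spaces.linear (*s) (*s) Y \<and>
     X \<circ> Xi = id \<and> Xi \<circ> X = id \<and> X \<circ> G = G \<circ> X \<and> X \<circ> Y = Y \<circ> X \<and>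
     (\<forall>v. Y (G v) = \<gamma> *s G (Y v)) \<and>
     (\<forall>v. (Y ^^ n) v = v - (X ^^ w) v) \<and> (X ^^ w) = (G ^^ n)"

text \<open>Action of the basis element x^k g^j y^i.\<close>
definition bact :: "('k^'d \<Rightarrow> 'k^'d) \<Rightarrow> ('k^'d \<Rightarrow> 'k^'d) \<Rightarrow> ('k^'d \<Rightarrow> 'k^'d) \<Rightarrow> ('k^'d \<Rightarrow> 'k^'d)
    \<Rightarrow> bidx \<Rightarrow> 'k^'d \<Rightarrow> 'k^'d" where
  "bact X Xi G Y b = (case b of (k,j,i) \<Rightarrow>
     (if 0 \<le> k then X ^^ nat k else Xi ^^ nat (- k)) \<circ> (G ^^ j) \<circ> (Y ^^ i))"

text \<open>A left H-comodule structure delta(v) = \<Sum>_b b \<otimes> D v b, with D v finitely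
  supported on basis indices.\<close>
definition hcomodule :: "nat \<Rightarrow> nat \<Rightarrow> 'k::field \<Rightarrow> ('k^'d \<Rightarrow> bidx \<Rightarrow> 'k^'d) \<Rightarrow> bool" where
  "hcomodule n w \<gamma> D \<longleftrightarrow>
     (\<forall>b. Vector_Spaces.linear (*s) (*s) (\<lambda>v. D v b)) \<and>
     (\<forall>v. finite (supp (D v)) \<and> supp (D v) \<subseteq> Bset n) \<and>
     (\<forall>v. (\<Sum>b\<in>supp (D v). counit b *s D v b) = v) \<and>
     (\<forall>v t1 t2. (\<Sum>b\<in>supp (D v). comult n w \<gamma> b (t1,t2) *s D v b) = D (D v t1) t2)"

text \<open>Yetter-Drinfeld compatibility
  delta(h.v) = h_(1) v_(-1) S(h_(3)) \<otimes> h_(2).v_(0), for h running over the basis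
  (equivalent to all h by linearity).\<close>
definition yd_module :: "nat \<Rightarrow> nat \<Rightarrow> 'k::field \<Rightarrow>
    ('k^'d \<Rightarrow> 'k^'d) \<Rightarrow> ('k^'d \<Rightarrow> 'k^'d) \<Rightarrow> ('k^'d \<Rightarrow> 'k^'d) \<Rightarrow> ('k^'d \<Rightarrow> 'k^'d)
    \<Rightarrow> ('k^'d \<Rightarrow> bidx \<Rightarrow> 'k^'d) \<Rightarrow> bool" where
  "yd_module n w \<gamma> X Xi G Y D \<longleftrightarrow>
     hmodule n w \<gamma> X Xi G Y \<and> hcomodule n w \<gamma> D \<and>
     (\<forall>b\<in>Bset n. \<forall>v. D (bact X Xi G Y b v) =
        (\<lambda>t. \<Sum>u\<in>supp (comult2 n w \<gamma> b). \<Sum>b'\<in>supp (D v).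
           (comult2 n w \<gamma> b u *
             hmul n w \<gamma> (hmul n w \<gamma> (bel (fst u)) (bel b')) (antip n w \<gamma> (snd (snd u))) t)
           *s bact X Xi G Y (fst (snd u)) (D v b')))"

definition yd_submodule :: "('k::field^'d \<Rightarrow> 'k^'d) \<Rightarrow> ('k^'d \<Rightarrow> 'k^'d) \<Rightarrow> ('k^'d \<Rightarrow> 'k^'d) \<Rightarrow> ('k^'d \<Rightarrow> 'k^'d)
    \<Rightarrow> ('k^'d \<Rightarrow> bidx \<Rightarrow> 'k^'d) \<Rightarrow> ('k^'d) set \<Rightarrow> bool" where
  "yd_submodule X Xi G Y D W \<longleftrightarrow> vec.subspace W \<and>
     X ` W \<subseteq> W \<and> Xi ` W \<subseteq> W \<and> G ` W \<subseteq> W \<and> Y ` W \<subseteq> W \<and>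
     (\<forall>u\<in>W. \<forall>b. D u b \<in> W)"

definition simple_yd :: "nat \<Rightarrow> nat \<Rightarrow> 'k::field \<Rightarrow>
    ('k^'d \<Rightarrow> 'k^'d) \<Rightarrow> ('k^'d \<Rightarrow> 'k^'d) \<Rightarrow> ('k^'d \<Rightarrow> 'k^'d) \<Rightarrow> ('k^'d \<Rightarrow> 'k^'d)
    \<Rightarrow> ('k^'d \<Rightarrow> bidx \<Rightarrow> 'k^'d) \<Rightarrow> bool" where
  "simple_yd n w \<gamma> X Xi G Y D \<longleftrightarrow> yd_module n w \<gamma> X Xi G Y D \<and> (UNIV :: ('k^'d) set) \<noteq> {0} \<and>
     (\<forall>W. yd_submodule X Xi G Y D W \<longrightarrow> W = {0} \<or> W = UNIV)"

text \<open>Group-likes G(H) = {g^j x^k}, i.e. the basis indices (k,j,0) with j < n.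
  A standard element of type (alpha, beta, h) with h = g^j x^k.\<close>
definition standard_elt :: "nat \<Rightarrow> ('k::field^'d \<Rightarrow> 'k^'d) \<Rightarrow> ('k^'d \<Rightarrow> 'k^'d)
    \<Rightarrow> ('k^'d \<Rightarrow> bidx \<Rightarrow> 'k^'d) \<Rightarrow> 'k^'d \<Rightarrow> 'k \<Rightarrow> 'k \<Rightarrow> bidx \<Rightarrow> bool" where
  "standard_elt n X G D v \<alpha> \<beta> h \<longleftrightarrow> v \<noteq> 0 \<and> \<alpha> \<noteq> 0 \<and> \<beta> \<noteq> 0 \<and>
     (\<exists>k j. h = (k, j, 0) \<and> j < n) \<and>
     X v = \<alpha> *s v \<and> G v = \<beta> *s v \<and> D v = (\<lambda>b. if b = h then v else 0)"

end

theory Submission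
  imports Defs
begin

text \<open>The vectors \<open>y\<^sup>i v\<close> are eigenvectors of \<open>x\<close> (eigenvalue \<open>\<alpha>\<close>) and of \<open>g\<close>
  (eigenvalue \<open>\<beta> \<gamma>\<^sup>-\<^sup>i\<close>), and \<open>y\<^sup>n v = (1 - \<alpha>\<^sup>w) v\<close>. Hence the span of
  \<open>v, y v, \<dots>, y\<^sup>n\<^sup>-\<^sup>1 v\<close> is an \<open>H\<close>-submodule; since \<open>\<delta>(v) = h \<otimes> v\<close>, the
  Yetter-Drinfeld condition writes \<open>\<delta>(y\<^sup>i v)\<close> with second tensor factors in \<open>H \<cdot> v\<close>, so it
  is also a subcomodule, and by simplicity it is all of \<open>V\<close>. The eigenvalues \<open>\<beta> \<gamma>\<^sup>-\<^sup>i\<close>,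
  \<open>i < n\<close>, are pairwise distinct, so the vectors \<open>y\<^sup>i v\<close> preceding the first vanishing one
  are linearly independent and span \<open>V\<close>: \<open>p + 1\<close> is the first \<open>i\<close> with \<open>y\<^sup>i v = 0\<close>, or
  \<open>n\<close> if there is none. Comparing with \<open>y\<^sup>n v = (1 - \<alpha>\<^sup>w) v\<close> and with \<open>\<beta>\<^sup>n = \<alpha>\<^sup>w\<close>
  (from \<open>g\<^sup>n = x\<^sup>w\<close>) gives all four claims.\<close>

context vector_space
begin

lemma funpow_linear_eigen:
  assumes "Vector_Spaces.linear scale scale f" and "f z = scale c z"
  shows "(f ^^ k) z = scale (c ^ k) z"
proof -
  interpret f: Vector_Spaces.linear scale scale f by fact
  show ?thesis
    by (induction k) (simp_all add: assms(2) f.scale mult.commute)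
qed

lemma funpow_linear_eq_0_mono:
  assumes "Vector_Spaces.linear scale scale f" and "(f ^^ i) z = 0" and "i \<le> j"
  shows "(f ^^ j) z = 0"
proof -
  interpret f: Vector_Spaces.linear scale scale f by fact
  have "(f ^^ k) 0 = 0" for k
    by (induction k) simp_all
  then show ?thesis
    using assms(2,3) by (metis funpow_add le_add_diff_inverse2 o_apply)
qed

lemma linear_span_closed:
  assumes "Vector_Spaces.linear scale scale f" and "\<And>x. x \<in> S \<Longrightarrow> f x \<in> span S" and "z \<in> span S"
  shows "f z \<in> span S"
proof -
  interpret f: Vector_Spaces.linear scale scale f by fact
  have "f ` span S = span (f ` S)"
    by (simp add: f.span_image)
  also have "\<dots> \<subseteq> span S"
    using assms(2) by (intro span_minimal subspace_span) auto
  finally show ?thesis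
    using assms(3) by blast
qed

lemma eigenvector_in_span_eq_0:
  assumes f: "Vector_Spaces.linear scale scale f" and "finite A"
    and eig: "\<And>i. i \<in> A \<Longrightarrow> f (u i) = scale (lam i) (u i)"
    and "z \<in> span (u ` A)" and "f z = scale \<mu> z" and "\<mu> \<notin> lam ` A"
  shows "z = 0"
  using assms(2-)
proof (induction A arbitrary: z rule: finite_induct)
  case empty
  then show ?case by simp
next
  case (insert a A)
  interpret f: Vector_Spaces.linear scale scale f by fact
  from insert.prems(2) obtain c where z': "z - scale c (u a) \<in> span (u ` A)"
    by (auto simp: span_insert)
  have closed: "f x \<in> span (u ` A)" if "x \<in> span (u ` A)" for x
    by (rule linear_span_closed[OF f _ that]) (use insert.prems(1) in \<open>auto intro!: span_scale[OF span_base]\<close>)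
  have "f (z - scale c (u a)) - scale (lam a) (z - scale c (u a)) \<in> span (u ` A)"
    by (rule span_diff[OF closed[OF z'] span_scale[OF z']])
  moreover have "f (z - scale c (u a)) - scale (lam a) (z - scale c (u a)) = scale (\<mu> - lam a) z"
    using insert.prems(1,3) by (simp add: f.diff f.scale scale_right_diff_distrib scale_left_diff_distrib mult.commute)
  ultimately have in_span: "scale (\<mu> - lam a) z \<in> span (u ` A)"
    by simp
  have eigen: "f (scale (\<mu> - lam a) z) = scale \<mu> (scale (\<mu> - lam a) z)"
    using insert.prems(3) by (simp add: f.scale mult.commute)
  have "scale (\<mu> - lam a) z = 0"
    by (rule insert.IH[OF _ in_span eigen]) (use insert.prems(1,4) in auto)
  then show ?case
    using insert.prems(4) by simp
qed

lemma independent_eigenvectors: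
  assumes f: "Vector_Spaces.linear scale scale f" and "finite A" and "inj_on lam A"
    and "\<And>i. i \<in> A \<Longrightarrow> u i \<noteq> 0" and "\<And>i. i \<in> A \<Longrightarrow> f (u i) = scale (lam i) (u i)"
  shows "independent (u ` A)"
  using assms(2-)
proof (induction A rule: finite_induct)
  case empty
  then show ?case by (simp add: independent_empty)
next
  case (insert a A)
  have "lam a \<notin> lam ` A"
    using insert.hyps(2) insert.prems(1) by auto
  then have "u a \<notin> span (u ` A)"
    using eigenvector_in_span_eq_0[OF f insert.hyps(1), of u lam "u a" "lam a"] insert.prems(2,3) by auto
  moreover have "independent (u ` A)"
    using insert by (auto intro: inj_on_subset)
  ultimately show ?case
    by (simp add: independent_insertI)
qed

lemma dim_span_eigenvectors:
  assumes f: "Vector_Spaces.linear scale scale f" and "finite A" and "inj_on lam A"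
    and nz: "\<And>i. i \<in> A \<Longrightarrow> u i \<noteq> 0" and eig: "\<And>i. i \<in> A \<Longrightarrow> f (u i) = scale (lam i) (u i)"
  shows "dim (span (u ` A)) = card A"
proof -
  have "inj_on u A"
  proof (rule inj_onI)
    fix i j assume "i \<in> A" "j \<in> A" "u i = u j"
    then have "scale (lam i - lam j) (u i) = 0"
      using eig by (metis right_minus_eq scale_left_diff_distrib)
    then show "i = j"
      using \<open>i \<in> A\<close> \<open>j \<in> A\<close> nz \<open>inj_on lam A\<close> by (auto dest: inj_onD)
  qed
  then show ?thesis
    using independent_eigenvectors[OF assms] by (simp add: dim_eq_card_independent card_image)
qed

lemma dim_span_orbit:
  assumes Y: "Vector_Spaces.linear scale scale Y" and G: "Vector_Spaces.linear scale scale G"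
    and eig: "\<And>i. G ((Y ^^ i) v) = scale (lam i) ((Y ^^ i) v)" and inj: "inj_on lam {..<n}"
  defines "d \<equiv> dim (span ((\<lambda>i. (Y ^^ i) v) ` {..<n}))"
  shows "d \<le> n" and "\<And>i. i < d \<Longrightarrow> (Y ^^ i) v \<noteq> 0" and "d < n \<Longrightarrow> (Y ^^ d) v = 0"
proof -
  obtain m where "m \<le> n" and nz: "\<And>i. i < m \<Longrightarrow> (Y ^^ i) v \<noteq> 0"
    and vanish: "m < n \<Longrightarrow> (Y ^^ m) v = 0"
    using ex_least_nat_le[of "\<lambda>i. (Y ^^ i) v = 0 \<or> i = n" n] by auto
  let ?u = "\<lambda>i. (Y ^^ i) v"
  have "?u i = 0" if "m \<le> i" and "i < n" for i
    using funpow_linear_eq_0_mono[OF Y vanish that(1)] that by simp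
  then have "?u i \<in> insert 0 (?u ` {..<m})" if "i < n" for i
    using that by (cases "i < m") auto
  then have "?u ` {..<n} \<subseteq> insert 0 (?u ` {..<m})"
    by auto
  moreover have "?u ` {..<m} \<subseteq> ?u ` {..<n}"
    using \<open>m \<le> n\<close> by auto
  ultimately have "span (?u ` {..<n}) = span (?u ` {..<m})"
    by (metis span_insert_0 span_mono subset_antisym)
  moreover have "dim (span (?u ` {..<m})) = m"
    using dim_span_eigenvectors[OF G, of "{..<m}" lam ?u] inj_on_subset[OF inj] \<open>m \<le> n\<close> nz eig
    by auto
  ultimately have "d = m"
    by (simp add: d_def)
  then show "d \<le> n" and "\<And>i. i < d \<Longrightarrow> (Y ^^ i) v \<noteq> 0" and "d < n \<Longrightarrow> (Y ^^ d) v = 0"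
    using \<open>m \<le> n\<close> nz vanish by simp_all
qed

end

lemma primitive_root_nonzero: "primitive_root n \<gamma> \<Longrightarrow> \<gamma> \<noteq> 0"
  unfolding primitive_root_def by (metis power_0_left zero_neq_one)

lemma primitive_root_inj_on_power:
  assumes "primitive_root n \<gamma>"
  shows "inj_on (\<lambda>i. \<gamma> ^ i) {..<n}"
proof (rule linorder_inj_onI)
  fix i j assume "i < j" "j \<in> {..<n}"
  have "\<gamma> ^ (j - i) \<noteq> 1"
    using assms \<open>i < j\<close> \<open>j \<in> {..<n}\<close> unfolding primitive_root_def by auto
  moreover have "\<gamma> ^ j = \<gamma> ^ i * \<gamma> ^ (j - i)"
    using \<open>i < j\<close> by (simp flip: power_add)
  ultimately show "\<gamma> ^ i \<noteq> \<gamma> ^ j"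
    using primitive_root_nonzero[OF assms] by auto
qed auto

lemma hmodule_linear:
  assumes "hmodule n w \<gamma> X Xi G Y"
  shows "Vector_Spaces.linear (*s) (*s) X" and "Vector_Spaces.linear (*s) (*s) Xi"
    and "Vector_Spaces.linear (*s) (*s) G" and "Vector_Spaces.linear (*s) (*s) Y"
  using assms unfolding hmodule_def by auto

lemma hmodule_X_Y_pow_eigen:
  assumes "hmodule n w \<gamma> X Xi G Y" and "X v = \<alpha> *s v"
  shows "X ((Y ^^ i) v) = \<alpha> *s (Y ^^ i) v"
proof (induction i)
  case 0
  then show ?case using assms(2) by simp
next
  case (Suc i)
  have "X \<circ> Y = Y \<circ> X"
    using assms(1) unfolding hmodule_def by simp
  then show ?case
    using Suc vec.linear_scale[OF hmodule_linear(4)[OF assms(1)]] by (metis comp_apply funpow.simps(2))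
qed

lemma hmodule_Xi_eigen:
  assumes "hmodule n w \<gamma> X Xi G Y" and "X z = \<alpha> *s z"
  shows "Xi z = inverse \<alpha> *s z"
proof -
  note lin = hmodule_linear(2)[OF assms(1)]
  have "Xi \<circ> X = id"
    using assms(1) unfolding hmodule_def by simp
  then have XiX: "Xi (\<alpha> *s z) = z"
    using assms(2) by (metis comp_apply id_apply)
  show ?thesis
  proof (cases "\<alpha> = 0")
    case True
    then show ?thesis
      using XiX vec.linear_0[OF lin] by simp
  next
    case False
    have "Xi z = inverse \<alpha> *s (\<alpha> *s Xi z)"
      using False by (simp add: vec.scale_scale)
    also have "\<dots> = inverse \<alpha> *s z"
      using XiX vec.linear_scale[OF lin] by simp
    finally show ?thesis .
  qed
qed

lemma hmodule_G_Y_pow_eigen: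
  assumes "hmodule n w \<gamma> X Xi G Y" and "\<gamma> \<noteq> 0" and "G v = \<beta> *s v"
  shows "G ((Y ^^ i) v) = (\<beta> / \<gamma> ^ i) *s (Y ^^ i) v"
proof (induction i)
  case 0
  then show ?case using assms(3) by simp
next
  case (Suc i)
  have "\<gamma> *s G ((Y ^^ Suc i) v) = Y (G ((Y ^^ i) v))"
    using assms(1) unfolding hmodule_def by simp
  also have "\<dots> = (\<beta> / \<gamma> ^ i) *s (Y ^^ Suc i) v"
    using Suc vec.linear_scale[OF hmodule_linear(4)[OF assms(1)]] by simp
  finally have "inverse \<gamma> *s (\<gamma> *s G ((Y ^^ Suc i) v)) = (inverse \<gamma> * (\<beta> / \<gamma> ^ i)) *s (Y ^^ Suc i) v"
    by (simp add: vec.scale_scale)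
  then show ?case
    using assms(2) by (simp add: vec.scale_scale field_simps)
qed

lemma hmodule_Y_pow_n:
  assumes "hmodule n w \<gamma> X Xi G Y" and "X v = \<alpha> *s v"
  shows "(Y ^^ n) v = (1 - \<alpha> ^ w) *s v"
  using assms vec.funpow_linear_eigen[OF hmodule_linear(1)[OF assms(1)] assms(2), of w]
  unfolding hmodule_def by (simp add: vec.scale_left_diff_distrib)

lemma hmodule_Y_pow_n_eq_0_iff:
  assumes "hmodule n w \<gamma> X Xi G Y" and "v \<noteq> 0" and "X v = \<alpha> *s v"
  shows "(Y ^^ n) v = 0 \<longleftrightarrow> \<alpha> ^ w = 1"
  using assms(2) by (simp only: hmodule_Y_pow_n[OF assms(1,3)] vec.scale_eq_0_iff) auto

lemma hmodule_eigenvalue_pow_eq: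
  assumes "hmodule n w \<gamma> X Xi G Y" and "v \<noteq> 0" and "X v = \<alpha> *s v" and "G v = \<beta> *s v"
  shows "\<beta> ^ n = \<alpha> ^ w"
proof -
  have "X ^^ w = G ^^ n"
    using assms(1) unfolding hmodule_def by simp
  then have "\<alpha> ^ w *s v = \<beta> ^ n *s v"
    using vec.funpow_linear_eigen[OF hmodule_linear(1)[OF assms(1)] assms(3), of w]
      vec.funpow_linear_eigen[OF hmodule_linear(3)[OF assms(1)] assms(4), of n]
    by auto
  then show ?thesis
    using assms(2) by (metis vec.scale_cancel_right)
qed

lemma bact_closed:
  assumes "\<And>z. z \<in> W \<Longrightarrow> X z \<in> W" and "\<And>z. z \<in> W \<Longrightarrow> Xi z \<in> W"
    and "\<And>z. z \<in> W \<Longrightarrow> G z \<in> W" and "\<And>z. z \<in> W \<Longrightarrow> Y z \<in> W" and "z \<in> W"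
  shows "bact X Xi G Y b z \<in> W"
proof -
  have pow: "(F ^^ k) z \<in> W" if "\<And>z. z \<in> W \<Longrightarrow> F z \<in> W" and "z \<in> W" for F k z
    using that by (induction k) auto
  show ?thesis
    by (cases b) (simp add: bact_def pow assms)
qed

lemma hmodule_span_Y_orbit_invariant:
  assumes hm: "hmodule n w \<gamma> X Xi G Y" and "\<gamma> \<noteq> 0" and Xv: "X v = \<alpha> *s v" and Gv: "G v = \<beta> *s v"
  defines "W \<equiv> vec.span ((\<lambda>i. (Y ^^ i) v) ` {..<n})"
  assumes "z \<in> W"
  shows "X z \<in> W" and "Xi z \<in> W" and "G z \<in> W" and "Y z \<in> W"
proof -
  note lin = hmodule_linear[OF hm]
  have orbit: "(Y ^^ i) v \<in> W" if "i < n" for i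
    using that unfolding W_def by (intro vec.span_base) auto
  have scaled: "c *s (Y ^^ i) v \<in> W" if "i < n" for c i
    using orbit[OF that] unfolding W_def by (rule vec.span_scale)
  have closed: "F z \<in> W" if "Vector_Spaces.linear (*s) (*s) F" and "\<And>i. i < n \<Longrightarrow> F ((Y ^^ i) v) \<in> W" for F
    using vec.linear_span_closed[OF that(1), of "(\<lambda>i. (Y ^^ i) v) ` {..<n}"] that(2) \<open>z \<in> W\<close>
    unfolding W_def by auto
  show "X z \<in> W"
    by (rule closed[OF lin(1)]) (simp add: hmodule_X_Y_pow_eigen[OF hm Xv] scaled)
  show "Xi z \<in> W"
    by (rule closed[OF lin(2)])
      (simp add: hmodule_Xi_eigen[OF hm hmodule_X_Y_pow_eigen[OF hm Xv]] scaled)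
  show "G z \<in> W"
    by (rule closed[OF lin(3)])
      (simp add: hmodule_G_Y_pow_eigen[OF hm \<open>\<gamma> \<noteq> 0\<close> Gv] scaled)
  show "Y z \<in> W"
  proof (rule closed[OF lin(4)])
    fix i assume "i < n"
    show "Y ((Y ^^ i) v) \<in> W"
    proof (cases "Suc i < n")
      case True
      then show ?thesis using orbit[of "Suc i"] by simp
    next
      case False
      then have "n = Suc i"
        using \<open>i < n\<close> by simp
      then have "Y ((Y ^^ i) v) = (1 - \<alpha> ^ w) *s (Y ^^ 0) v"
        using hmodule_Y_pow_n[OF hm Xv] by simp
      moreover have "(1 - \<alpha> ^ w) *s (Y ^^ 0) v \<in> W"
        using \<open>n = Suc i\<close> by (intro scaled) simp
      ultimately show ?thesis
        by (simp only:)
    qed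
  qed
qed

lemma yd_submodule_span_Y_orbit:
  assumes yd: "yd_module n w \<gamma> X Xi G Y D" and "\<gamma> \<noteq> 0" and std: "standard_elt n X G D v \<alpha> \<beta> h"
  defines "W \<equiv> vec.span ((\<lambda>i. (Y ^^ i) v) ` {..<n})"
  shows "yd_submodule X Xi G Y D W"
proof -
  have hm: "hmodule n w \<gamma> X Xi G Y" and com: "hcomodule n w \<gamma> D"
    and compat: "\<And>b z. b \<in> Bset n \<Longrightarrow> D (bact X Xi G Y b z) = (\<lambda>t. \<Sum>u\<in>supp (comult2 n w \<gamma> b). \<Sum>b'\<in>supp (D z).
           (comult2 n w \<gamma> b u *
             hmul n w \<gamma> (hmul n w \<gamma> (bel (fst u)) (bel b')) (antip n w \<gamma> (snd (snd u))) t)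
           *s bact X Xi G Y (fst (snd u)) (D z b'))"
    using yd unfolding yd_module_def by auto
  from std have Xv: "X v = \<alpha> *s v" and Gv: "G v = \<beta> *s v" and Dv: "D v = (\<lambda>b. if b = h then v else 0)"
    and "0 < n"
    unfolding standard_elt_def by auto
  note inv = hmodule_span_Y_orbit_invariant[OF hm \<open>\<gamma> \<noteq> 0\<close> Xv Gv, folded W_def]
  have "v \<in> W"
    using \<open>0 < n\<close> unfolding W_def by (intro vec.span_base) (auto intro: image_eqI[of _ _ 0])
  then have Dv_in: "D v b \<in> W" for b
    unfolding Dv by (simp add: W_def vec.span_zero)
  have D_orbit: "D ((Y ^^ i) v) b \<in> W" if "i < n" for i b
  proof -
    have "(Y ^^ i) v = bact X Xi G Y (0, 0, i) v" and "(0, 0, i) \<in> Bset n"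
      using that \<open>0 < n\<close> by (simp_all add: bact_def Bset_def)
    then show ?thesis
      using compat[of "(0, 0, i)" v] bact_closed[OF inv Dv_in] unfolding W_def
      by (simp add: vec.span_sum vec.span_scale)
  qed
  have linD: "Vector_Spaces.linear (*s) (*s) (\<lambda>z. D z b)" for b
    using com unfolding hcomodule_def by blast
  have "D z b \<in> W" if "z \<in> W" for z b
    using vec.linear_span_closed[OF linD _ that[unfolded W_def]] D_orbit unfolding W_def by blast
  then show ?thesis
    unfolding yd_submodule_def using inv by (auto simp: W_def vec.subspace_span)
qed

lemma simple_yd_span_Y_orbit:
  assumes "simple_yd n w \<gamma> X Xi G Y D" and "\<gamma> \<noteq> 0" and std: "standard_elt n X G D v \<alpha> \<beta> h"
  shows "vec.span ((\<lambda>i. (Y ^^ i) v) ` {..<n}) = UNIV"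
proof -
  from std have "v \<noteq> 0" and "0 < n"
    unfolding standard_elt_def by auto
  then have "v \<in> vec.span ((\<lambda>i. (Y ^^ i) v) ` {..<n})"
    by (intro vec.span_base) (auto intro: image_eqI[of _ _ 0])
  moreover have "yd_submodule X Xi G Y D (vec.span ((\<lambda>i. (Y ^^ i) v) ` {..<n}))"
    using assms(1) yd_submodule_span_Y_orbit[OF _ assms(2) std] unfolding simple_yd_def by blast
  ultimately show ?thesis
    using assms(1) \<open>v \<noteq> 0\<close> unfolding simple_yd_def by blast
qed

theorem lemma3p6:
  fixes n w p :: nat and \<gamma> \<alpha> \<beta> :: "'k::field_char_0" and h :: bidx
    and X Xi G Y :: "'k^'d \<Rightarrow> 'k^'d" and D :: "'k^'d \<Rightarrow> bidx \<Rightarrow> 'k^'d" and v :: "'k^'d"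
  assumes "alg_closed TYPE('k)"
    and "0 < n" and "0 < w" and "primitive_root n \<gamma>"
    and "simple_yd n w \<gamma> X Xi G Y D"
    and "CARD('d) = p + 1"
    and "standard_elt n X G D v \<alpha> \<beta> h"
  shows "p + 1 \<le> n \<and>
    (p + 1 < n \<longrightarrow> (Y ^^ (p + 1)) v = 0) \<and>
    ((Y ^^ (p + 1)) v = 0 \<longleftrightarrow> \<alpha> ^ w = 1 \<and> \<beta> ^ n = 1) \<and>
    ((Y ^^ (p + 1)) v \<noteq> 0 \<longleftrightarrow> \<alpha> ^ w = \<beta> ^ n \<and> \<beta> ^ n \<noteq> 1)"
proof -
  from assms(5) have hm: "hmodule n w \<gamma> X Xi G Y"
    unfolding simple_yd_def yd_module_def by simp
  from assms(7) have "v \<noteq> 0" and "\<beta> \<noteq> 0" and Xv: "X v = \<alpha> *s v" and Gv: "G v = \<beta> *s v"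
    unfolding standard_elt_def by auto
  have "\<gamma> \<noteq> 0"
    using assms(4) by (rule primitive_root_nonzero)
  have dim: "vec.dim (vec.span ((\<lambda>i. (Y ^^ i) v) ` {..<n})) = p + 1"
    using simple_yd_span_Y_orbit[OF assms(5) \<open>\<gamma> \<noteq> 0\<close> assms(7)] vec_dim_card[where 'a='k and 'n='d] assms(6)
    by (simp del: vec.dim_UNIV)
  have "inj_on (\<lambda>i. \<beta> / \<gamma> ^ i) {..<n}"
    using primitive_root_inj_on_power[OF assms(4)] \<open>\<beta> \<noteq> 0\<close> by (simp add: inj_on_def divide_cancel_left)
  note orbit = vec.dim_span_orbit[OF hmodule_linear(4,3)[OF hm] hmodule_G_Y_pow_eigen[OF hm \<open>\<gamma> \<noteq> 0\<close> Gv] this,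
      unfolded dim]
  have "(Y ^^ (p + 1)) v = 0 \<longleftrightarrow> \<alpha> ^ w = 1"
  proof (cases "p + 1 < n")
    case True
    then have "(Y ^^ n) v = 0"
      using vec.funpow_linear_eq_0_mono[OF hmodule_linear(4)[OF hm] orbit(3)[OF True], of n] by simp
    then show ?thesis
      using orbit(3)[OF True] hmodule_Y_pow_n_eq_0_iff[OF hm \<open>v \<noteq> 0\<close> Xv] by simp
  next
    case False
    then show ?thesis
      using orbit(1) hmodule_Y_pow_n_eq_0_iff[OF hm \<open>v \<noteq> 0\<close> Xv] by simp
  qed
  then show ?thesis
    using orbit(1,3) hmodule_eigenvalue_pow_eq[OF hm \<open>v \<noteq> 0\<close> Xv Gv] by auto
qed

end
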